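(* There exist a nonrecursive set $A\le_T\emptyset'$, a family $\{B_q\}_{q\in\mathbb Q\cap(1,2)}$ of subsets of $\mathbb N$, and a family $\{W_n\}_{n\in\mathbb N}$ of subsets of $\mathbb N$ such that (i) $B_q\equiv_{\rm bfo}A$ for every $q\in\mathbb Q\cap(1,2)$; (ii) $W_n\equiv_{\rm bfo}A$ for every $n\in\mathbb N$; (iii) $B_p<_1 B_q$ whenever $p,q\in\mathbb Q\cap(1,2)$ and $p<q$; (iv) $W_n\not\le_1 W_m$ whenever $n\ne m$. Consequently, the bounded finite-one degree of $A$ contains both a copy of $(\mathbb Q,\le)$ and an infinite antichain of $1$-degrees.
   Context: All sets are subsets of $\mathbb N=\{0,1,\dots\}$; $\emptyset'$ is the Turing jump of the empty set; nonrecursive means not computable. For $A,B\subseteq\mathbb N$: $A\le_1 B$ means there is a total computable injective $f:\mathbb N\to\mathbb N$ with $x\in A\iff f(x)\in B$ for all $x$. $A\le_{\rm bfo}B$ means there are a total computable $f:\mathbb N\to\mathbb N$ and a constant $c\ge1$ with $x\in A\iff f(x)\in B$ for all $x$ and $|f^{-1}(y)|\le c$ for all $y$. For $r\in\{1,{\rm bfo}\}$, $A\equiv_r B$ means $A\le_r B$ and $B\le_r A$; $A<_r B$ means $A\le_r B$ and $B\not\le_r A$. The equivalence classes of $\equiv_1$ are the $1$-degrees, those of $\equiv_{\rm bfo}$ the bounded finite-one degrees. Since $\le_1$ implies $\le_{\rm bfo}$, each bounded finite-one degree is a union of $1$-degrees; these are partially ordered by $\deg_1(X)\le\deg_1(Y)\iff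 X\le_1 Y$. "Contains a copy of" a partial order means that there is an order-embedding (preserving and reflecting $\le$) of it into this poset of $1$-degrees. *)

theory Defs
  imports Complex_Main "HOL-Library.Nat_Bijection"
begin

text \<open>
  Kleene's partial recursive functions, in the unary presentation: several arguments
  are packed into one by the library's Cantor pairing function \<^const>\<open>prod_encode\<close>.
\<close>

datatype prog =
    Zero | Succ | Fst | Snd | Query
  | Pairing prog prog | Comp prog prog | PrimRec prog prog | Mu prog

text \<open>
  \<open>eval X p x\<close> is the result of program \<open>p\<close> with oracle \<open>X\<close> on input \<open>x\<close>;
  \<^const>\<open>None\<close> means divergence. \<open>PrimRec f g\<close> computes, on input \<open>(a, n)\<close>,
  the function \<open>h\<close> with \<open>h(a, 0) = f(a)\<close> and \<open>h(a, m + 1) = g(a, (m, h(a, m)))\<close>.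
  \<open>Mu f\<close> returns on \<open>x\<close> the least \<open>n\<close> with \<open>f(x, n) = 0\<close>,
  and diverges unless \<open>f(x, m)\<close> converges for all smaller \<open>m\<close>.
\<close>

primrec eval :: "nat set \<Rightarrow> prog \<Rightarrow> nat \<Rightarrow> nat option" where
  "eval X Zero x = Some 0"
| "eval X Succ x = Some (Suc x)"
| "eval X Fst x = Some (fst (prod_decode x))"
| "eval X Snd x = Some (snd (prod_decode x))"
| "eval X Query x = Some (if x \<in> X then 1 else 0)"
| "eval X (Pairing f g) x =
     Option.bind (eval X f x) (\<lambda>a. Option.bind (eval X g x) (\<lambda>b. Some (prod_encode (a, b))))"
| "eval X (Comp f g) x = Option.bind (eval X g x) (eval X f)"
| "eval X (PrimRec f g) x =
     (let (a, n) = prod_decode x in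
      rec_nat (eval X f a)
        (\<lambda>m r. Option.bind r (\<lambda>v. eval X g (prod_encode (a, prod_encode (m, v))))) n)"
| "eval X (Mu f) x =
     (let halts_at = (\<lambda>n. eval X f (prod_encode (x, n)) = Some 0 \<and>
                          (\<forall>m<n. eval X f (prod_encode (x, m)) \<noteq> None))
      in if \<exists>n. halts_at n then Some (LEAST n. halts_at n) else None)"

definition computable_in :: "nat set \<Rightarrow> (nat \<Rightarrow> nat) \<Rightarrow> bool" where
  "computable_in X f \<longleftrightarrow> (\<exists>p. \<forall>x. eval X p x = Some (f x))"

text \<open>
  With the empty oracle, \<^const>\<open>Query\<close> is the constant zero function, so this is the
  usual notion of a total computable function.
\<close>

definition computable :: "(nat \<Rightarrow> nat) \<Rightarrow> bool" where
  "computable f \<longleftrightarrow> computable_in {} f"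

definition char_fun :: "nat set \<Rightarrow> nat \<Rightarrow> nat" where
  "char_fun A x = (if x \<in> A then 1 else 0)"

definition recursive_set :: "nat set \<Rightarrow> bool" where
  "recursive_set A \<longleftrightarrow> computable (char_fun A)"

definition turing_le :: "nat set \<Rightarrow> nat set \<Rightarrow> bool"  (infix "\<le>\<^sub>T" 50) where
  "A \<le>\<^sub>T X \<longleftrightarrow> computable_in X (char_fun A)"

text \<open>An effective bijective Goedel numbering; syntactic operations on programs act on
  numbers by the explicit formulas below.\<close>

primrec prog_num :: "prog \<Rightarrow> nat" where
  "prog_num Zero = 0"
| "prog_num Succ = 1"
| "prog_num Fst = 2"
| "prog_num Snd = 3"
| "prog_num Query = 4"
| "prog_num (Pairing f g) = 5 + 4 * prod_encode (prog_num f, prog_num g)"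
| "prog_num (Comp f g) = 6 + 4 * prod_encode (prog_num f, prog_num g)"
| "prog_num (PrimRec f g) = 7 + 4 * prod_encode (prog_num f, prog_num g)"
| "prog_num (Mu f) = 8 + 4 * prog_num f"

lemma inj_prog_num: "inj prog_num"
proof (rule injI)
  fix p q
  show "prog_num p = prog_num q \<Longrightarrow> p = q"
  proof (induction p arbitrary: q)
    case Zero then show ?case by (cases q) auto
  next
    case Succ then show ?case by (cases q) auto
  next
    case Fst then show ?case by (cases q) auto
  next
    case Snd then show ?case by (cases q) auto
  next
    case Query then show ?case by (cases q) auto
  next
    case (Pairing f g) then show ?case by (cases q) (simp_all, presburger+)
  next
    case (Comp f g) then show ?case by (cases q) (simp_all, presburger+)
  next
    case (PrimRec f g) then show ?case by (cases q) (simp_all, presburger+)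
  next
    case (Mu f) then show ?case by (cases q) (simp_all, presburger+)
  qed
qed

lemma surj_prog_num: "surj prog_num"
proof -
  have "\<exists>p. prog_num p = n" for n
  proof (induction n rule: less_induct)
    case (less n)
    show ?case
    proof (cases "n < 5")
      case True
      then consider "n = 0" | "n = 1" | "n = 2" | "n = 3" | "n = 4" by linarith
      then show ?thesis
        by cases (metis prog_num.simps(1), metis prog_num.simps(2), metis prog_num.simps(3),
                  metis prog_num.simps(4), metis prog_num.simps(5))
    next
      case False
      define k where "k = (n - 5) div 4"
      obtain a b where ab: "k = prod_encode (a, b)"
        by (metis prod_decode_inverse surj_pair)
      have "k < n" using False by (simp add: k_def)
      then have "a < n" "b < n"
        using le_prod_encode_1[of a b] le_prod_encode_2[of b a] ab by linarith+
      then obtain p q r where "prog_num p = a" "prog_num q = b" "prog_num r = k"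
        using less \<open>k < n\<close> by metis
      then have *: "prog_num (Pairing p q) = 5 + 4 * k" "prog_num (Comp p q) = 6 + 4 * k"
        "prog_num (PrimRec p q) = 7 + 4 * k" "prog_num (Mu r) = 8 + 4 * k"
        by (simp_all add: ab)
      have "n = 5 + 4 * k \<or> n = 6 + 4 * k \<or> n = 7 + 4 * k \<or> n = 8 + 4 * k"
        using False unfolding k_def by presburger
      then show ?thesis using * by metis
    qed
  qed
  then show ?thesis by (metis surj_def)
qed

lemma bij_prog_num: "bij prog_num"
  by (simp add: bij_def inj_prog_num surj_prog_num)

definition phi :: "nat set \<Rightarrow> nat \<Rightarrow> nat \<Rightarrow> nat option" where
  "phi X e = eval X (inv prog_num e)"

definition jump :: "nat set \<Rightarrow> nat set" where
  "jump X = {e. phi X e e \<noteq> None}"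

definition one_le :: "nat set \<Rightarrow> nat set \<Rightarrow> bool"  (infix "\<le>\<^sub>1" 50) where
  "A \<le>\<^sub>1 B \<longleftrightarrow> (\<exists>f. computable f \<and> inj f \<and> (\<forall>x. x \<in> A \<longleftrightarrow> f x \<in> B))"

text \<open>Finiteness of the fibres is explicit because \<^const>\<open>card\<close> is 0 on infinite sets.\<close>

definition bfo_le :: "nat set \<Rightarrow> nat set \<Rightarrow> bool"  (infix "\<le>\<^sub>b\<^sub>f\<^sub>o" 50) where
  "A \<le>\<^sub>b\<^sub>f\<^sub>o B \<longleftrightarrow> (\<exists>f c. computable f \<and> c \<ge> 1 \<and> (\<forall>x. x \<in> A \<longleftrightarrow> f x \<in> B) \<and>
     (\<forall>y. finite (f -` {y}) \<and> card (f -` {y}) \<le> c))"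

definition one_equiv :: "nat set \<Rightarrow> nat set \<Rightarrow> bool"  (infix "\<equiv>\<^sub>1" 50) where
  "A \<equiv>\<^sub>1 B \<longleftrightarrow> A \<le>\<^sub>1 B \<and> B \<le>\<^sub>1 A"

definition bfo_equiv :: "nat set \<Rightarrow> nat set \<Rightarrow> bool"  (infix "\<equiv>\<^sub>b\<^sub>f\<^sub>o" 50) where
  "A \<equiv>\<^sub>b\<^sub>f\<^sub>o B \<longleftrightarrow> A \<le>\<^sub>b\<^sub>f\<^sub>o B \<and> B \<le>\<^sub>b\<^sub>f\<^sub>o A"

definition one_less :: "nat set \<Rightarrow> nat set \<Rightarrow> bool"  (infix "<\<^sub>1" 50) where
  "A <\<^sub>1 B \<longleftrightarrow> A \<le>\<^sub>1 B \<and> \<not> B \<le>\<^sub>1 A"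

definition one_degree :: "nat set \<Rightarrow> nat set set" where
  "one_degree X = {Y. Y \<equiv>\<^sub>1 X}"

definition bfo_degree :: "nat set \<Rightarrow> nat set set" where
  "bfo_degree X = {Y. Y \<equiv>\<^sub>b\<^sub>f\<^sub>o X}"

definition one_degrees_in :: "nat set set \<Rightarrow> nat set set set" where
  "one_degrees_in \<B> = {D. (\<exists>X. D = one_degree X) \<and> D \<subseteq> \<B>}"

definition one_degree_le :: "nat set set \<Rightarrow> nat set set \<Rightarrow> bool" where
  "one_degree_le D E \<longleftrightarrow> (\<exists>X\<in>D. \<exists>Y\<in>E. X \<le>\<^sub>1 Y)"

definition contains_copy_of :: "nat set set \<Rightarrow> 'a set \<Rightarrow> ('a \<Rightarrow> 'a \<Rightarrow> bool) \<Rightarrow> bool" where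
  "contains_copy_of \<B> P le \<longleftrightarrow>
     (\<exists>h. (\<forall>x\<in>P. h x \<in> one_degrees_in \<B>) \<and>
          (\<forall>x\<in>P. \<forall>y\<in>P. le x y \<longleftrightarrow> one_degree_le (h x) (h y)))"

definition contains_infinite_antichain :: "nat set set \<Rightarrow> bool" where
  "contains_infinite_antichain \<B> \<longleftrightarrow>
     (\<exists>S. S \<subseteq> one_degrees_in \<B> \<and> infinite S \<and>
          (\<forall>D\<in>S. \<forall>E\<in>S. D \<noteq> E \<longrightarrow> \<not> one_degree_le D E))"

lemma one_le_refl: "A \<le>\<^sub>1 A"
proof -
  have "eval {} (Pairing Fst Snd) x = Some x" for x by simp
  then have "computable (\<lambda>x. x)" unfolding computable_def computable_in_def by blast
  then show ?thesis unfolding one_le_def by (intro exI[of _ "\<lambda>x. x"]) simp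
qed

lemma one_le_trans:
  assumes "A \<le>\<^sub>1 B" "B \<le>\<^sub>1 C"
  shows "A \<le>\<^sub>1 C"
proof -
  obtain f g where f: "computable f" "inj f" "\<forall>x. x \<in> A \<longleftrightarrow> f x \<in> B"
    and g: "computable g" "inj g" "\<forall>x. x \<in> B \<longleftrightarrow> g x \<in> C"
    using assms unfolding one_le_def by blast
  obtain p q where "\<forall>x. eval {} p x = Some (f x)" "\<forall>x. eval {} q x = Some (g x)"
    using f(1) g(1) unfolding computable_def computable_in_def by blast
  then have "eval {} (Comp q p) x = Some ((g \<circ> f) x)" for x by simp
  then have "computable (g \<circ> f)" unfolding computable_def computable_in_def by blast
  moreover have "inj (g \<circ> f)" using f(2) g(2) by (simp add: inj_compose)
  ultimately show ?thesis using f(3) g(3) unfolding one_le_def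
    by (intro exI[of _ "g \<circ> f"]) simp
qed

lemma one_degree_le_iff: "one_degree_le (one_degree X) (one_degree Y) \<longleftrightarrow> X \<le>\<^sub>1 Y"
  unfolding one_degree_le_def one_degree_def one_equiv_def
  by (auto intro: one_le_refl one_le_trans)

lemma one_le_imp_bfo_le: "A \<le>\<^sub>1 B \<Longrightarrow> A \<le>\<^sub>b\<^sub>f\<^sub>o B"
proof -
  assume "A \<le>\<^sub>1 B"
  then obtain f where f: "computable f" "inj f" "\<forall>x. x \<in> A \<longleftrightarrow> f x \<in> B"
    unfolding one_le_def by blast
  have "finite (f -` {y}) \<and> card (f -` {y}) \<le> 1" for y
    using f(2) by (simp add: finite_vimageI card_vimage_inj_on_le[of f UNIV "{y}", simplified])
  then show ?thesis using f unfolding bfo_le_def by blast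
qed

end

theory Submission
  imports Defs "HOL-Library.Infinite_Set"
begin

text \<open>
  A set \<open>G \<le>\<^sub>T \<emptyset>'\<close> is built in stages so that no computable \<open>f\<close> which infinitely often differs from the
  identity (and is finite-one on the relevant values) reduces \<open>G\<close> to itself: whenever \<open>f\<close> relates
  membership of \<open>a\<close> to membership of a different, not yet decided number, the two bits are set so
  that \<open>f\<close> fails. For recursive \<open>S\<close>, let \<open>G\<^sub>S\<close> contain two copies of each bit of \<open>G\<close> with index in \<open>S\<close>,
  one copy of the others, and infinitely many dummy positions. All \<open>G\<^sub>S\<close> have the same bounded
  finite-one degree, and \<open>S \<subseteq> T\<close> gives \<open>G\<^sub>S \<le>\<^sub>1 G\<^sub>T\<close>. If \<open>S - T\<close> is infinite, then by the pigeonhole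
  principle a one-one reduction of \<open>G\<^sub>S\<close> to \<open>G\<^sub>T\<close> would infinitely often relate a bit to another one,
  so \<open>G\<^sub>S \<le>\<^sub>1 G\<^sub>T\<close> fails. It remains to take a rational chain and an antichain of recursive sets modulo
  finite differences.
\<close>

section \<open>Closure properties of computability\<close>

abbreviation c1 :: "nat \<Rightarrow> nat" where "c1 x \<equiv> fst (prod_decode x)"
abbreviation c2 :: "nat \<Rightarrow> nat" where "c2 x \<equiv> snd (prod_decode x)"

definition decidable_in :: "nat set \<Rightarrow> (nat \<Rightarrow> bool) \<Rightarrow> bool" where
  "decidable_in X P \<longleftrightarrow> computable_in X (\<lambda>x. if P x then 1 else 0)"

named_theorems comp_intros

lemma decidable_in_mem_iff: "decidable_in X (\<lambda>x. x \<in> S) \<longleftrightarrow> computable_in X (char_fun S)"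
  by (simp add: decidable_in_def char_fun_def[abs_def])

lemma computable_in_const [comp_intros]: "computable_in X (\<lambda>x. c)"
proof (induction c)
  case 0
  have "\<forall>x. eval X Zero x = Some 0" by simp
  then show ?case unfolding computable_in_def by blast
next
  case (Suc c)
  then obtain p where "\<forall>x. eval X p x = Some c" unfolding computable_in_def by blast
  then have "\<forall>x. eval X (Comp Succ p) x = Some (Suc c)" by simp
  then show ?case unfolding computable_in_def by blast
qed

lemma computable_in_compose:
  assumes "computable_in X g" "computable_in X f"
  shows "computable_in X (\<lambda>x. g (f x))"
proof -
  obtain p q where "\<forall>x. eval X p x = Some (g x)" "\<forall>x. eval X q x = Some (f x)"
    using assms unfolding computable_in_def by blast
  then have "\<forall>x. eval X (Comp p q) x = Some (g (f x))" by simp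
  then show ?thesis unfolding computable_in_def by blast
qed

lemma computable_in_pair [comp_intros]:
  assumes "computable_in X f" "computable_in X g"
  shows "computable_in X (\<lambda>x. prod_encode (f x, g x))"
proof -
  obtain p q where "\<forall>x. eval X p x = Some (f x)" "\<forall>x. eval X q x = Some (g x)"
    using assms unfolding computable_in_def by blast
  then have "\<forall>x. eval X (Pairing p q) x = Some (prod_encode (f x, g x))" by simp
  then show ?thesis unfolding computable_in_def by blast
qed

lemma computable_in_id [comp_intros]: "computable_in X (\<lambda>x. x)"
proof -
  have "\<forall>x. eval X (Pairing Fst Snd) x = Some x" by simp
  then show ?thesis unfolding computable_in_def by blast
qed

lemma computable_in_Suc [comp_intros]:
  assumes "computable_in X f" shows "computable_in X (\<lambda>x. Suc (f x))"
proof -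
  have "\<forall>x. eval X Succ x = Some (Suc x)" by simp
  then have "computable_in X Suc" unfolding computable_in_def by blast
  then show ?thesis using assms by (rule computable_in_compose)
qed

lemma computable_in_fst [comp_intros]:
  assumes "computable_in X f" shows "computable_in X (\<lambda>x. c1 (f x))"
proof -
  have "\<forall>x. eval X Fst x = Some (c1 x)" by simp
  then have "computable_in X c1" unfolding computable_in_def by blast
  then show ?thesis using assms by (rule computable_in_compose)
qed

lemma computable_in_snd [comp_intros]:
  assumes "computable_in X f" shows "computable_in X (\<lambda>x. c2 (f x))"
proof -
  have "\<forall>x. eval X Snd x = Some (c2 x)" by simp
  then have "computable_in X c2" unfolding computable_in_def by blast
  then show ?thesis using assms by (rule computable_in_compose)
qed

text \<open>The step is required in uncurried form because computability is defined for unary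
  functions. It may depend on the argument \<open>x\<close>, which the recursion therefore carries
  along as its parameter.\<close>

lemma computable_in_rec_nat [comp_intros]:
  assumes "computable_in X f" "computable_in X k"
    "computable_in X (\<lambda>z. g (c1 z) (c1 (c2 z)) (c2 (c2 z)))"
  shows "computable_in X (\<lambda>x. rec_nat (f x) (\<lambda>m v. g x m v) (k x))"
proof -
  obtain p q where p: "\<forall>x. eval X p x = Some (f x)"
    and q: "\<forall>z. eval X q z = Some (g (c1 z) (c1 (c2 z)) (c2 (c2 z)))"
    using assms unfolding computable_in_def by blast
  have "rec_nat (eval X p a)
      (\<lambda>m r. Option.bind r (\<lambda>v. eval X q (prod_encode (a, prod_encode (m, v))))) n
      = Some (rec_nat (f a) (\<lambda>m v. g a m v) n)" for a n
    by (induction n) (simp_all add: p q)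
  then have "\<forall>x. eval X (PrimRec p q) x = Some (rec_nat (f (c1 x)) (\<lambda>m v. g (c1 x) m v) (c2 x))"
    by (simp add: split_beta)
  then have *: "computable_in X (\<lambda>x. rec_nat (f (c1 x)) (\<lambda>m v. g (c1 x) m v) (c2 x))"
    unfolding computable_in_def by blast
  have "computable_in X (\<lambda>x. prod_encode (x, k x))"
    by (intro comp_intros assms)
  from computable_in_compose[OF * this] show ?thesis by simp
qed

lemma computable_in_add [comp_intros]:
  assumes "computable_in X f" "computable_in X g"
  shows "computable_in X (\<lambda>x. f x + g x)"
proof -
  have "computable_in X (\<lambda>x. rec_nat (f x) (\<lambda>m v. Suc v) (g x))"
    by (intro comp_intros assms)
  moreover have "rec_nat a (\<lambda>m v. Suc v) n = a + n" for a n
    by (induction n) auto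
  ultimately show ?thesis by simp
qed

lemma computable_in_mult [comp_intros]:
  assumes "computable_in X f" "computable_in X g"
  shows "computable_in X (\<lambda>x. f x * g x)"
proof -
  have "computable_in X (\<lambda>x. rec_nat 0 (\<lambda>m v. v + f x) (g x))"
    by (intro comp_intros assms computable_in_compose[OF assms(1)])
  moreover have "rec_nat 0 (\<lambda>m v. v + a) n = a * n" for a n :: nat
    by (induction n) auto
  ultimately show ?thesis by simp
qed

lemma computable_in_diff [comp_intros]:
  assumes "computable_in X f" "computable_in X g"
  shows "computable_in X (\<lambda>x. f x - g x)"
proof -
  have "computable_in X (\<lambda>x. rec_nat 0 (\<lambda>m v. m) x)"
    by (intro comp_intros)
  moreover have "rec_nat 0 (\<lambda>m v. m) n = n - 1" for n :: nat
    by (cases n) auto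
  ultimately have pred: "computable_in X (\<lambda>x. x - 1)" by simp
  have "computable_in X (\<lambda>x. rec_nat (f x) (\<lambda>m v. v - 1) (g x))"
    by (intro comp_intros assms computable_in_compose[OF pred])
  moreover have "rec_nat a (\<lambda>m v. v - 1) n = a - n" for a n :: nat
    by (induction n) auto
  ultimately show ?thesis by simp
qed

lemma computable_in_if [comp_intros]:
  assumes "decidable_in X P" "computable_in X f" "computable_in X g"
  shows "computable_in X (\<lambda>x. if P x then f x else g x)"
proof -
  have "computable_in X (\<lambda>x. rec_nat (g x) (\<lambda>m v. f x) (if P x then 1 else 0))"
    by (intro computable_in_rec_nat assms computable_in_compose[OF assms(2)]
        assms(1)[unfolded decidable_in_def] comp_intros)
  moreover have "rec_nat (g x) (\<lambda>m v. f x) (if P x then 1 else 0) = (if P x then f x else g x)" for x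
    by simp
  ultimately show ?thesis by simp
qed

lemma decidable_in_compose:
  "decidable_in X P \<Longrightarrow> computable_in X f \<Longrightarrow> decidable_in X (\<lambda>x. P (f x))"
  unfolding decidable_in_def by (rule computable_in_compose)

lemma decidable_in_const [comp_intros]: "decidable_in X (\<lambda>x. b)"
  unfolding decidable_in_def by (rule computable_in_const)

lemma decidable_in_not [comp_intros]:
  assumes "decidable_in X P" shows "decidable_in X (\<lambda>x. \<not> P x)"
proof -
  have *: "(\<lambda>x. if \<not> P x then 1 else 0) = (\<lambda>x. if P x then 0 else (1::nat))"
    by auto
  show ?thesis
    unfolding decidable_in_def * by (intro comp_intros assms)
qed

lemma decidable_in_conj [comp_intros]:
  assumes "decidable_in X P" "decidable_in X Q" shows "decidable_in X (\<lambda>x. P x \<and> Q x)"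
proof -
  have "computable_in X (\<lambda>x. if P x then if Q x then 1 else 0 else 0)"
    by (intro comp_intros assms)
  moreover have "(if P x then if Q x then 1 else 0 else 0) = (if P x \<and> Q x then 1 else (0::nat))" for x
    by simp
  ultimately show ?thesis unfolding decidable_in_def by simp
qed

lemma decidable_in_disj [comp_intros]:
  assumes "decidable_in X P" "decidable_in X Q" shows "decidable_in X (\<lambda>x. P x \<or> Q x)"
proof -
  have "decidable_in X (\<lambda>x. \<not> (\<not> P x \<and> \<not> Q x))" by (intro comp_intros assms)
  then show ?thesis by simp
qed

lemma decidable_in_le [comp_intros]:
  assumes "computable_in X f" "computable_in X g" shows "decidable_in X (\<lambda>x. f x \<le> g x)"
proof -
  have "computable_in X (\<lambda>x. 1 - (f x - g x))" by (intro comp_intros assms)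
  moreover have "1 - (f x - g x) = (if f x \<le> g x then 1 else 0)" for x by simp
  ultimately show ?thesis unfolding decidable_in_def by simp
qed

lemma decidable_in_less [comp_intros]:
  assumes "computable_in X f" "computable_in X g" shows "decidable_in X (\<lambda>x. f x < g x)"
  unfolding Suc_le_eq[symmetric] by (intro comp_intros assms)

lemma decidable_in_eq [comp_intros]:
  assumes "computable_in X f" "computable_in X g" shows "decidable_in X (\<lambda>x. f x = g x)"
proof -
  have "decidable_in X (\<lambda>x. f x \<le> g x \<and> g x \<le> f x)" by (intro comp_intros assms)
  then show ?thesis by (simp add: order_eq_iff)
qed

lemma decidable_in_oracle [comp_intros]:
  assumes "computable_in X f" shows "decidable_in X (\<lambda>x. f x \<in> X)"
proof -
  have "\<forall>x. eval X Query x = Some (if x \<in> X then 1 else 0)" by simp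
  then have "decidable_in X (\<lambda>x. x \<in> X)" unfolding decidable_in_def computable_in_def by blast
  then show ?thesis using assms by (rule decidable_in_compose)
qed

lemma computable_in_Least [comp_intros]:
  assumes "decidable_in X (\<lambda>z. P (c1 z) (c2 z))" and ex: "\<And>x. \<exists>n. P x n"
  shows "computable_in X (\<lambda>x. LEAST n. P x n)"
proof -
  \<comment> \<open>\<open>Mu\<close> stops at the value 0, so the search runs over the indicator of
    the negation.\<close>
  have "decidable_in X (\<lambda>z. \<not> P (c1 z) (c2 z))" by (intro comp_intros assms)
  then obtain p where p: "\<forall>z. eval X p z = Some (if \<not> P (c1 z) (c2 z) then 1 else 0)"
    unfolding decidable_in_def computable_in_def by blast
  have "\<forall>x. eval X (Mu p) x = Some (LEAST n. P x n)"
    using ex by (simp add: p)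
  then show ?thesis unfolding computable_in_def by blast
qed

lemma decidable_in_bex [comp_intros]:
  assumes P: "decidable_in X (\<lambda>z. P (c1 z) (c2 z))" and k: "computable_in X k"
  shows "decidable_in X (\<lambda>x. \<exists>s\<le>k x. P x s)"
proof -
  \<comment> \<open>The disjunct \<open>k x < s\<close> makes the search total: it ends at
    \<open>Suc (k x)\<close> at the latest, and ends earlier exactly if a witness exists.\<close>
  have "computable_in X (\<lambda>x. LEAST s. k x < s \<or> P x s)"
    by (intro comp_intros P computable_in_compose[OF k]) auto
  then have "decidable_in X (\<lambda>x. (LEAST s. k x < s \<or> P x s) \<le> k x)"
    by (rule decidable_in_le[OF _ k])
  moreover have "(LEAST s. k x < s \<or> P x s) \<le> k x \<longleftrightarrow> (\<exists>s\<le>k x. P x s)" for x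
  proof
    assume *: "(LEAST s. k x < s \<or> P x s) \<le> k x"
    have "k x < (LEAST s. k x < s \<or> P x s) \<or> P x (LEAST s. k x < s \<or> P x s)"
      by (rule LeastI[of _ "Suc (k x)"]) simp
    then show "\<exists>s\<le>k x. P x s" using * by auto
  next
    assume "\<exists>s\<le>k x. P x s"
    then obtain s where s: "s \<le> k x" "P x s" by blast
    have "(LEAST s. k x < s \<or> P x s) \<le> s" by (rule Least_le) (simp add: s)
    then show "(LEAST s. k x < s \<or> P x s) \<le> k x" using s by simp
  qed
  ultimately show ?thesis by simp
qed

section \<open>Questions decided by the halting problem\<close>

text \<open>Parameters are hard-wired as constants, so the code of the resulting program is
  computable from them: the s-m-n property in the form used for oracle queries.\<close>

primrec const_prog :: "nat \<Rightarrow> prog" where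
  "const_prog 0 = Zero"
| "const_prog (Suc n) = Comp Succ (const_prog n)"

lemma eval_const_prog [simp]: "eval X (const_prog n) x = Some n"
  by (induction n) auto

lemma computable_in_const_prog [comp_intros]:
  assumes "computable_in X f" shows "computable_in X (\<lambda>x. prog_num (const_prog (f x)))"
proof -
  have "computable_in X (\<lambda>x. rec_nat 0 (\<lambda>m v. 6 + 4 * prod_encode (1, v)) (f x))"
    by (intro comp_intros assms)
  moreover have "rec_nat 0 (\<lambda>m v. 6 + 4 * prod_encode (1, v)) n = prog_num (const_prog n)" for n
    by (induction n) auto
  ultimately show ?thesis by simp
qed

lemma prog_num_in_jump: "prog_num p \<in> jump X \<longleftrightarrow> eval X p (prog_num p) \<noteq> None"
  by (simp add: jump_def phi_def inv_f_f[OF inj_prog_num])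

lemma prog_num_inv [simp]: "prog_num (inv prog_num e) = e"
  by (simp add: surj_f_inv_f[OF surj_prog_num])

text \<open>The program \<open>T e a v\<close> ignores its input, runs program \<open>e\<close> on
  \<open>a\<close>, and then halts if the result is \<open>v\<close> and searches forever otherwise.
  Asking whether it halts on its own code therefore answers the question.\<close>

lemma decidable_in_phi_eq:
  assumes "computable_in (jump {}) e" "computable_in (jump {}) a" "computable_in (jump {}) v"
  shows "decidable_in (jump {}) (\<lambda>z. phi {} (e z) (a z) = Some (v z))"
proof -
  have "computable_in {} (\<lambda>z. if c1 (c1 z) = c2 (c1 z) then 0 else 1)"
    by (intro comp_intros)
  then obtain d where d: "\<And>z. eval {} d z = Some (if c1 (c1 z) = c2 (c1 z) then 0 else 1)"
    unfolding computable_in_def by blast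
  define T where "T e a v = Comp (Mu d) (Pairing (Comp (inv prog_num e) (const_prog a)) (const_prog v))"
    for e a v
  have "prog_num (T e a v) \<in> jump {} \<longleftrightarrow> phi {} e a = Some v" for e a v
    unfolding prog_num_in_jump
    by (cases "phi {} e a") (auto simp: T_def d phi_def)
  moreover have "decidable_in (jump {}) (\<lambda>z. prog_num (T (e z) (a z) (v z)) \<in> jump {})"
    by (rule decidable_in_oracle) (simp add: T_def, intro comp_intros assms)
  ultimately show ?thesis by simp
qed

text \<open>Since the search passes to the next argument only after convergence, a total
  function is searched exhaustively without dovetailing, and no universal program is needed.\<close>

lemma decidable_in_search:
  assumes t: "decidable_in {} (\<lambda>z. R (c1 (c1 z)) (c2 (c1 z)) (c2 z))"
    and e: "computable_in (jump {}) e" and n: "computable_in (jump {}) n"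
  shows "decidable_in (jump {}) (\<lambda>z. \<exists>a. (\<forall>a'\<le>a. phi {} (e z) a' \<noteq> None) \<and>
           R (n z) a (the (phi {} (e z) a)))"
proof -
  have "decidable_in {} (\<lambda>z. \<not> R (c1 (c1 z)) (c2 (c1 z)) (c2 z))"
    by (intro comp_intros t)
  then obtain p where p: "\<And>z. eval {} p z = Some (if \<not> R (c1 (c1 z)) (c2 (c1 z)) (c2 z) then 1 else 0)"
    unfolding decidable_in_def computable_in_def by blast
  define T where "T e n =
      Mu (Comp p (Pairing (Pairing (const_prog n) Snd) (Comp (inv prog_num e) Snd)))" for e n
  have "prog_num (T e n) \<in> jump {} \<longleftrightarrow>
      (\<exists>a. (\<forall>a'\<le>a. phi {} e a' \<noteq> None) \<and> R n a (the (phi {} e a)))" for e n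
  proof -
    define F where "F = Comp p (Pairing (Pairing (const_prog n) Snd) (Comp (inv prog_num e) Snd))"
    have F: "eval {} F (prod_encode (x, a)) =
        (case phi {} e a of None \<Rightarrow> None | Some v \<Rightarrow> Some (if R n a v then 0 else 1))" for x a
      by (cases "phi {} e a") (simp_all add: F_def p phi_def)
    have F0: "eval {} F (prod_encode (x, a)) = Some 0 \<longleftrightarrow>
        phi {} e a \<noteq> None \<and> R n a (the (phi {} e a))" for x a
      by (auto simp: F split: option.split)
    have F1: "eval {} F (prod_encode (x, a)) = None \<longleftrightarrow> phi {} e a = None" for x a
      by (simp add: F split: option.split)
    have iff: "(\<forall>a'\<le>a. Q a') \<longleftrightarrow> Q a \<and> (\<forall>m<a. Q m)" for Q and a :: nat
      by (auto simp: le_less)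
    have "prog_num (T e n) \<in> jump {} \<longleftrightarrow> (\<exists>a. phi {} e a \<noteq> None \<and> R n a (the (phi {} e a)) \<and>
        (\<forall>m<a. phi {} e m \<noteq> None))"
      unfolding prog_num_in_jump T_def F_def[symmetric] by (auto simp: Let_def F0 F1)
    also have "\<dots> \<longleftrightarrow> (\<exists>a. (\<forall>a'\<le>a. phi {} e a' \<noteq> None) \<and> R n a (the (phi {} e a)))"
      by (simp only: iff conj_ac)
    finally show ?thesis .
  qed
  moreover have "decidable_in (jump {}) (\<lambda>z. prog_num (T (e z) (n z)) \<in> jump {})"
    by (rule decidable_in_oracle) (simp add: T_def, intro comp_intros e n)
  ultimately show ?thesis by simp
qed

section \<open>The generic set\<close>

text \<open>A value \<open>\<langle>b, 0\<rangle>\<close> refers to the bit \<open>b\<close> of the set under construction, a value \<open>\<langle>b, j\<rangle>\<close> with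
  \<open>j > 0\<close> to a position outside the set. Since references to bits below \<open>n\<close> are skipped,
  a stage never consults the bits that are already fixed.\<close>

definition useful :: "nat \<Rightarrow> nat \<Rightarrow> nat \<Rightarrow> bool" where
  "useful n a v \<longleftrightarrow> n \<le> a \<and> v \<noteq> prod_encode (a, 0) \<and> (c2 v \<noteq> 0 \<or> n \<le> c1 v)"

lemma decidable_in_useful [comp_intros]:
  assumes "computable_in X n" "computable_in X a" "computable_in X v"
  shows "decidable_in X (\<lambda>z. useful (n z) (a z) (v z))"
  unfolding useful_def by (intro comp_intros assms)

definition found :: "nat \<Rightarrow> nat \<Rightarrow> bool" where
  "found e n \<longleftrightarrow> (\<exists>a. (\<forall>a'\<le>a. phi {} e a' \<noteq> None) \<and> useful n a (the (phi {} e a)))"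

text \<open>The first disjunct makes the search total, with value \<open>0\<close> if there is nothing to find.\<close>

definition witness :: "nat \<Rightarrow> nat \<Rightarrow> nat" where
  "witness e n = (LEAST w. \<not> found e n \<or> (useful n (c1 w) (c2 w) \<and> phi {} e (c1 w) = Some (c2 w)))"

text \<open>The summand \<open>2\<close> leaves a gap at the end of every stage, which keeps the set coinfinite.\<close>

primrec bound :: "nat \<Rightarrow> nat" where
  "bound 0 = 0"
| "bound (Suc s) = (let w = witness s (bound s) in bound s + c1 w + c1 (c2 w) + 2)"

text \<open>Stage \<open>s\<close> treats the program with code \<open>s\<close>. The number added
  there is at least \<open>bound s\<close>, hence at least \<open>s\<close>, so the restriction
  \<open>s \<le> a\<close> loses nothing and makes membership a bounded search.\<close>

definition generic :: "nat set" where
  "generic = {a. \<exists>s\<le>a. found s (bound s) \<and> a = c1 (witness s (bound s))}"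

lemma witness_exists:
  "\<exists>w. \<not> found e n \<or> (useful n (c1 w) (c2 w) \<and> phi {} e (c1 w) = Some (c2 w))"
proof (cases "found e n")
  case True
  then obtain a where "phi {} e a \<noteq> None" "useful n a (the (phi {} e a))"
    unfolding found_def by blast
  then show ?thesis by (intro exI[of _ "prod_encode (a, the (phi {} e a))"]) auto
qed simp

lemma witness:
  assumes "found e n"
  shows "useful n (c1 (witness e n)) (c2 (witness e n))"
    and "phi {} e (c1 (witness e n)) = Some (c2 (witness e n))"
  using LeastI_ex[OF witness_exists[of e n]] assms unfolding witness_def by auto

lemma decidable_in_found [comp_intros]:
  assumes "computable_in (jump {}) e" "computable_in (jump {}) n"
  shows "decidable_in (jump {}) (\<lambda>z. found (e z) (n z))"
  unfolding found_def by (intro decidable_in_search assms comp_intros)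

lemma computable_in_witness [comp_intros]:
  assumes e: "computable_in (jump {}) e" and n: "computable_in (jump {}) n"
  shows "computable_in (jump {}) (\<lambda>z. witness (e z) (n z))"
  unfolding witness_def
  by (intro comp_intros decidable_in_phi_eq computable_in_compose[OF e] computable_in_compose[OF n]
      witness_exists)

lemma bound_eq_rec_nat:
  "bound s = rec_nat 0 (\<lambda>s v. v + c1 (witness s v) + c1 (c2 (witness s v)) + 2) s"
  by (induction s) (simp_all add: Let_def)

lemma computable_in_bound [comp_intros]:
  assumes "computable_in (jump {}) f" shows "computable_in (jump {}) (\<lambda>z. bound (f z))"
  unfolding bound_eq_rec_nat by (intro comp_intros assms)

lemma generic_le_jump: "generic \<le>\<^sub>T jump {}"
proof -
  have "decidable_in (jump {}) (\<lambda>a. \<exists>s\<le>a. found s (bound s) \<and> a = c1 (witness s (bound s)))"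
    by (intro comp_intros)
  then show ?thesis
    by (simp add: turing_le_def decidable_in_mem_iff[symmetric] generic_def)
qed

lemma strict_mono_bound: "strict_mono bound"
  by (simp add: strict_mono_Suc_iff Let_def)

text \<open>Each stage adds only the first component of its own witness, which lies in the block of
  that stage, and distinct blocks are disjoint because \<open>bound\<close> increases.\<close>

lemma generic_interval:
  assumes "bound s \<le> x" "x < bound (Suc s)" "x \<in> generic"
  shows "x = c1 (witness s (bound s))"
proof -
  obtain s' where s': "found s' (bound s')" "x = c1 (witness s' (bound s'))"
    using assms(3) unfolding generic_def by blast
  have "bound s' \<le> x" "x < bound (Suc s')"
    using witness(1)[OF s'(1)] s'(2) by (auto simp: useful_def Let_def)
  then have "bound s' < bound (Suc s)" "bound s < bound (Suc s')"
    using assms by linarith+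
  then have "s' = s"
    using strict_mono_less[OF strict_mono_bound] by (metis less_Suc_eq_le order.antisym)
  then show ?thesis using s' by simp
qed

lemma infinite_compl_generic: "infinite (- generic)"
  unfolding infinite_nat_iff_unbounded
proof
  fix m
  \<comment> \<open>The last number of block \<open>m\<close> exceeds the only number that stage
    \<open>m\<close> can add.\<close>
  define x where "x = bound (Suc m) - 1"
  have x: "x = bound m + c1 (witness m (bound m)) + c1 (c2 (witness m (bound m))) + 1"
    by (simp add: x_def Let_def)
  have "x \<notin> generic"
    using generic_interval[of m x] by (auto simp: x Let_def)
  moreover have "m < x"
    using strict_mono_imp_increasing[OF strict_mono_bound, of m] x by simp
  ultimately show "\<exists>x>m. x \<in> - generic" by blast
qed

definition copies :: "nat set \<Rightarrow> nat set" where
  "copies S = {y. c1 y \<in> generic \<and> (c2 y = 0 \<or> (c2 y = 1 \<and> c1 y \<in> S))}"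

text \<open>At the stage numbered by a program for \<open>f\<close> the search succeeds. Its
  argument enters \<open>generic\<close>, while its value is a dummy position or refers to another
  bit of the same block, which stays out.\<close>

lemma generic_diagonal:
  assumes "computable f" and useful: "\<And>n. \<exists>a. useful n a (f a)"
  shows "\<exists>a. a \<in> generic \<longleftrightarrow> f a \<notin> copies {}"
proof -
  obtain p where p: "\<forall>x. eval {} p x = Some (f x)"
    using assms(1) unfolding computable_def computable_in_def by blast
  define s where "s = prog_num p"
  have phi: "phi {} s x = Some (f x)" for x
    by (simp add: phi_def s_def inv_f_f[OF inj_prog_num] p)
  define w where "w = witness s (bound s)"
  have fd: "found s (bound s)"
    unfolding found_def phi using useful by simp
  note w = witness[OF fd, folded w_def]
  have v: "c2 w = f (c1 w)" using w(2) phi by simp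
  have "s \<le> c1 w"
    using w(1) strict_mono_imp_increasing[OF strict_mono_bound, of s] by (simp add: useful_def)
  then have "c1 w \<in> generic" using fd unfolding generic_def w_def by blast
  moreover have "f (c1 w) \<notin> copies {}"
  proof
    assume *: "f (c1 w) \<in> copies {}"
    then have "c2 (c2 w) = 0" "c1 (c2 w) \<in> generic" by (auto simp: copies_def v)
    moreover from this have "bound s \<le> c1 (c2 w)" using w(1) by (simp add: useful_def)
    \<comment> \<open>The summand \<open>c1 (c2 w)\<close> in \<open>bound\<close> places the bit
      referred to in the same block, which has at most one member.\<close>
    ultimately have "c1 (c2 w) = c1 w"
      using generic_interval[of s "c1 (c2 w)"] by (simp add: w_def Let_def)
    then show False using w(1) \<open>c2 (c2 w) = 0\<close> unfolding useful_def
      by (metis prod.collapse prod_decode_inverse)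
  qed
  ultimately show ?thesis by blast
qed

section \<open>Reductions between the sets of copies\<close>

lemma copies_empty_le_jump: "copies {} \<le>\<^sub>T jump {}"
proof -
  have G: "decidable_in (jump {}) (\<lambda>x. x \<in> generic)"
    using generic_le_jump by (simp add: turing_le_def decidable_in_mem_iff)
  have "decidable_in (jump {}) (\<lambda>y. c1 y \<in> generic \<and> c2 y = 0)"
    by (intro comp_intros decidable_in_compose[OF G])
  then show ?thesis
    by (simp add: turing_le_def decidable_in_mem_iff[symmetric] copies_def)
qed

lemma not_recursive_copies_empty: "\<not> recursive_set (copies {})"
proof
  assume "recursive_set (copies {})"
  then have "decidable_in {} (\<lambda>x. x \<in> copies {})"
    by (simp add: recursive_set_def computable_def decidable_in_mem_iff)
  then have "decidable_in {} (\<lambda>x. prod_encode (x, 0) \<in> copies {})"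
    by (rule decidable_in_compose) (intro comp_intros)
  then have G: "decidable_in {} (\<lambda>x. x \<in> generic)" by (simp add: copies_def)
  \<comment> \<open>A decision procedure for \<open>generic\<close> would give this reduction to
    \<open>copies {}\<close>, which sends every nonmember to a dummy position and is thus useful at
    each of the infinitely many nonmembers.\<close>
  define f where "f a = (if a \<in> generic then prod_encode (a, 0) else prod_encode (a, 1))" for a
  have "computable f"
    unfolding f_def[abs_def] computable_def by (intro comp_intros G)
  moreover have "\<exists>a. useful n a (f a)" for n
  proof -
    obtain a where "a > n" "a \<notin> generic"
      using infinite_compl_generic unfolding infinite_nat_iff_unbounded by auto
    then show ?thesis by (intro exI[of _ a]) (simp add: useful_def f_def)
  qed
  ultimately have "\<exists>a. a \<in> generic \<longleftrightarrow> f a \<notin> copies {}"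
    by (rule generic_diagonal)
  then show False by (simp add: copies_def f_def split: if_splits)
qed

text \<open>The positions \<open>\<langle>x, i\<rangle>\<close> with \<open>i \<ge> 2\<close> are never in the set, so they leave room for the
  unused second copies.\<close>

lemma copies_mono:
  assumes "decidable_in {} (\<lambda>x. x \<in> S)" "S \<subseteq> T"
  shows "copies S \<le>\<^sub>1 copies T"
proof -
  define f where "f y = (if c2 y = 0 \<or> (c2 y = 1 \<and> c1 y \<in> S) then y else prod_encode (c1 y, Suc (c2 y)))" for y
  have "computable f"
    unfolding f_def[abs_def] computable_def
    by (intro comp_intros decidable_in_compose[OF assms(1)])
  moreover have "inj f"
  proof (rule injI)
    fix x y assume *: "f x = f y"
    obtain a i b j where "x = prod_encode (a, i)" "y = prod_encode (b, j)"
      by (metis prod_decode_inverse surj_pair)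
    then show "x = y" using * by (auto simp: f_def split: if_splits)
  qed
  moreover have "\<forall>y. y \<in> copies S \<longleftrightarrow> f y \<in> copies T"
    using assms(2) by (auto simp: copies_def f_def)
  ultimately show ?thesis unfolding one_le_def by blast
qed

lemma copies_bfo_equiv:
  assumes "decidable_in {} (\<lambda>x. x \<in> S)"
  shows "copies S \<equiv>\<^sub>b\<^sub>f\<^sub>o copies {}"
proof -
  \<comment> \<open>Second copies are merged with first copies, so a fibre has at most two
    elements.\<close>
  define f where "f y = (if c2 y = 1 \<and> c1 y \<in> S then prod_encode (c1 y, 0) else y)" for y
  have "computable f"
    unfolding f_def[abs_def] computable_def
    by (intro comp_intros decidable_in_compose[OF assms])
  moreover have "\<forall>y. y \<in> copies S \<longleftrightarrow> f y \<in> copies {}"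
    by (auto simp: copies_def f_def)
  moreover have "finite (f -` {y}) \<and> card (f -` {y}) \<le> 2" for y
  proof -
    have sub: "f -` {y} \<subseteq> {y, prod_encode (c1 y, 1)}"
      by (auto simp: f_def split: if_splits) (metis One_nat_def prod.collapse prod_decode_inverse)
    have "card {y, prod_encode (c1 y, 1)} \<le> 2" by (simp add: card_insert_if)
    then show ?thesis using sub by (meson card_mono finite.intros finite_subset order_trans)
  qed
  ultimately have "copies S \<le>\<^sub>b\<^sub>f\<^sub>o copies {}"
    unfolding bfo_le_def by (intro exI[of _ f] exI[of _ 2]) simp
  moreover have "copies {} \<le>\<^sub>b\<^sub>f\<^sub>o copies S"
    by (intro one_le_imp_bfo_le copies_mono) (simp_all add: decidable_in_const)
  ultimately show ?thesis unfolding bfo_equiv_def by blast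
qed

text \<open>If \<open>a \<in> S - T\<close>, then an injection cannot send both copies of \<open>a\<close> to the only copy of \<open>a\<close>
  in the target, so the value at one of them does not look at the bit \<open>a\<close>.\<close>

lemma copies_not_le:
  assumes S: "decidable_in {} (\<lambda>x. x \<in> S)" and T: "decidable_in {} (\<lambda>x. x \<in> T)"
    and inf: "infinite (S - T)"
  shows "\<not> copies S \<le>\<^sub>1 copies T"
proof
  assume "copies S \<le>\<^sub>1 copies T"
  then obtain f where f: "computable f" "inj f" "\<And>x. x \<in> copies S \<longleftrightarrow> f x \<in> copies T"
    unfolding one_le_def by blast
  \<comment> \<open>\<open>r\<close> reduces \<open>copies T\<close> to \<open>copies {}\<close>:
    genuine copies go to the first copy, all other positions to a dummy.\<close>
  define r where "r y = (if c2 y = 0 \<or> (c2 y = 1 \<and> c1 y \<in> T)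
      then prod_encode (c1 y, 0) else prod_encode (c1 y, 1))" for y
  have comp_r: "computable_in {} r"
    unfolding r_def[abs_def] by (intro comp_intros decidable_in_compose[OF T])
  have comp_f: "computable_in {} f" using f(1) by (simp add: computable_def)
  have r: "r y \<in> copies {} \<longleftrightarrow> y \<in> copies T" for y
    by (auto simp: r_def copies_def)
  \<comment> \<open>The second copy of \<open>a\<close> is used exactly if the image of the first
    one refers to \<open>a\<close> itself.\<close>
  define i where "i a = (if r (f (prod_encode (a, 0))) = prod_encode (a, 0) then 1 else (0::nat))" for a
  \<comment> \<open>The default \<open>prod_encode (a, 0)\<close> reduces correctly and is never
    \<open>useful\<close>.\<close>
  define g where "g a = (if a \<in> S \<and> a \<notin> T then r (f (prod_encode (a, i a))) else prod_encode (a, 0))" for a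
  have "computable g"
    unfolding g_def[abs_def] i_def computable_def
    by (intro comp_intros computable_in_compose[OF comp_r] computable_in_compose[OF comp_f]
        decidable_in_compose[OF S] decidable_in_compose[OF T])
  have i: "i a = 0 \<or> i a = 1" for a by (simp add: i_def)
  have red: "a \<in> generic \<longleftrightarrow> g a \<in> copies {}" for a
  proof (cases "a \<in> S \<and> a \<notin> T")
    case True
    then have "g a \<in> copies {} \<longleftrightarrow> prod_encode (a, i a) \<in> copies S"
      by (simp add: g_def r f(3))
    then show ?thesis using True i[of a] by (auto simp: copies_def)
  qed (auto simp: g_def copies_def)
  have ne: "g a \<noteq> prod_encode (a, 0)" if a: "a \<in> S" "a \<notin> T" for a
  proof
    assume *: "g a = prod_encode (a, 0)"
    have 0: "y = prod_encode (a, 0)" if "r y = prod_encode (a, 0)" for y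
      using that a by (auto simp: r_def split: if_splits) (metis prod.collapse prod_decode_inverse)
    show False
    proof (cases "r (f (prod_encode (a, 0))) = prod_encode (a, 0)")
      case True
      then have "r (f (prod_encode (a, 1))) = prod_encode (a, 0)"
        using * a by (simp add: g_def i_def)
      then have "f (prod_encode (a, 1)) = f (prod_encode (a, 0))" using 0 True by metis
      then show False using injD[OF f(2)] by fastforce
    next
      case False
      then show False using * a by (simp add: g_def i_def)
    qed
  qed
  have "\<exists>a. useful n a (g a)" for n
  proof (rule ccontr)
    assume no: "\<nexists>a. useful n a (g a)"
    \<comment> \<open>If nothing is useful, \<open>g a\<close> for \<open>a\<close> in
      \<open>D\<close> is the first copy of a bit below \<open>n\<close>, so the injective
      \<open>h\<close> maps the infinite \<open>D\<close> into the finitely many copies of these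
      bits.\<close>
    define D where "D = (S - T) - {..<n}"
    define h where "h a = f (prod_encode (a, i a))" for a
    have "infinite D" using inf by (simp add: D_def)
    moreover have "inj_on h D"
      by (auto simp: h_def inj_on_def dest!: injD[OF f(2)])
    moreover have "h ` D \<subseteq> prod_encode ` ({..<n} \<times> {..1})"
    proof
      fix y assume "y \<in> h ` D"
      then obtain a where "a \<in> D" and y: "y = h a" by blast
      then have a: "a \<in> S" "a \<notin> T" "n \<le> a" by (auto simp: D_def)
      then have "c2 (g a) = 0" "c1 (g a) < n"
        using no ne[of a] unfolding useful_def by (meson not_le)+
      then have "c1 y < n" "c2 y \<le> 1"
        using a y by (auto simp: g_def h_def r_def split: if_splits)
      then have "prod_decode y \<in> {..<n} \<times> {..1}" by (auto simp: mem_Times_iff)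
      then show "y \<in> prod_encode ` ({..<n} \<times> {..1})"
        by (metis image_eqI prod_decode_inverse)
    qed
    ultimately show False
      by (meson finite_SigmaI finite_atMost finite_imageI finite_imageD finite_lessThan finite_subset)
  qed
  with \<open>computable g\<close> have "\<exists>a. a \<in> generic \<longleftrightarrow> g a \<notin> copies {}"
    by (rule generic_diagonal)
  then show False by (simp add: red)
qed

section \<open>Bounded finite-one degrees as unions of 1-degrees\<close>

lemma bfo_le_trans:
  assumes "A \<le>\<^sub>b\<^sub>f\<^sub>o B" "B \<le>\<^sub>b\<^sub>f\<^sub>o C"
  shows "A \<le>\<^sub>b\<^sub>f\<^sub>o C"
proof -
  obtain f c where f: "computable f" "c \<ge> 1" "\<forall>x. x \<in> A \<longleftrightarrow> f x \<in> B"
      "\<And>y. finite (f -` {y})" "\<And>y. card (f -` {y}) \<le> c"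
    using assms(1) unfolding bfo_le_def by blast
  obtain g d where g: "computable g" "d \<ge> 1" "\<forall>x. x \<in> B \<longleftrightarrow> g x \<in> C"
      "\<And>y. finite (g -` {y})" "\<And>y. card (g -` {y}) \<le> d"
    using assms(2) unfolding bfo_le_def by blast
  have "computable (\<lambda>x. g (f x))"
    using g(1) f(1) unfolding computable_def by (rule computable_in_compose)
  moreover have "finite ((\<lambda>x. g (f x)) -` {y}) \<and> card ((\<lambda>x. g (f x)) -` {y}) \<le> d * c" for y
  proof -
    have eq: "(\<lambda>x. g (f x)) -` {y} = (\<Union>z\<in>g -` {y}. f -` {z})" by auto
    have "card (\<Union>z\<in>g -` {y}. f -` {z}) \<le> (\<Sum>z\<in>g -` {y}. card (f -` {z}))"
      by (rule card_UN_le[OF g(4)])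
    also have "\<dots> \<le> card (g -` {y}) * c"
      using sum_bounded_above[of "g -` {y}" "\<lambda>z. card (f -` {z})" c] f(5) by simp
    also have "\<dots> \<le> d * c" using g(5) by simp
    finally show ?thesis unfolding eq using f(4) g(4) by simp
  qed
  moreover have "d * c \<ge> 1" using f(2) g(2) by (simp add: Suc_leI)
  ultimately show ?thesis using f(3) g(3) unfolding bfo_le_def
    by (intro exI[of _ "\<lambda>x. g (f x)"] exI[of _ "d * c"]) simp
qed

lemma one_degree_in_bfo_degree:
  assumes "X \<equiv>\<^sub>b\<^sub>f\<^sub>o A"
  shows "one_degree X \<in> one_degrees_in (bfo_degree A)"
  using assms unfolding one_degrees_in_def one_degree_def bfo_degree_def one_equiv_def bfo_equiv_def
  by (blast intro: bfo_le_trans one_le_imp_bfo_le)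

section \<open>A chain and an antichain of recursive sets\<close>

text \<open>The number \<open>\<langle>\<langle>i, j\<rangle>, \<langle>k, l\<rangle>\<rangle>\<close> stands for the rational \<open>(i - j) / (k + 1)\<close>; the padding \<open>l\<close> makes
  every rational occur infinitely often.\<close>

definition rat_of_code :: "nat \<Rightarrow> rat" where
  "rat_of_code x = (of_nat (c1 (c1 x)) - of_nat (c2 (c1 x))) / of_nat (Suc (c1 (c2 x)))"

definition rat_cut :: "rat \<Rightarrow> nat set" where
  "rat_cut q = {x. rat_of_code x < q}"

lemma decidable_in_rat_cut: "decidable_in X (\<lambda>x. x \<in> rat_cut q)"
proof -
  obtain u v where uv: "quotient_of q = (u, v)" by (cases "quotient_of q")
  then have v: "v > 0" and q: "q = of_int u / of_int v"
    using quotient_of_denom_pos quotient_of_div by blast+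
  \<comment> \<open>The inequality \<open>(i - j) / (k + 1) < u / v\<close> is cleared of
    denominators, and negative terms change sides, so that only natural numbers occur.\<close>
  have "decidable_in X (\<lambda>x. c1 (c1 x) * nat v + nat (- u) * Suc (c1 (c2 x))
      < nat u * Suc (c1 (c2 x)) + c2 (c1 x) * nat v)"
    by (intro comp_intros)
  moreover have "i * nat v + nat (- u) * Suc k < nat u * Suc k + j * nat v \<longleftrightarrow>
      (of_nat i - of_nat j) / of_nat (Suc k) < q" for i j k
  proof -
    have "i * nat v + nat (- u) * Suc k < nat u * Suc k + j * nat v \<longleftrightarrow>
        int (i * nat v + nat (- u) * Suc k) < int (nat u * Suc k + j * nat v)"
      by (rule of_nat_less_iff[symmetric])
    also have "\<dots> \<longleftrightarrow> (int i - int j) * v < u * int (Suc k)"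
      using v by (cases "u \<ge> 0") (simp_all add: algebra_simps)
    also have "\<dots> \<longleftrightarrow> (of_int ((int i - int j) * v) :: rat) < of_int (u * int (Suc k))"
      by (rule of_int_less_iff[symmetric])
    also have "\<dots> \<longleftrightarrow> (of_nat i - of_nat j) / of_nat (Suc k) < q"
      using v unfolding q by (simp add: divide_simps mult.commute del: of_nat_Suc)
    finally show ?thesis .
  qed
  ultimately show ?thesis by (simp add: rat_cut_def rat_of_code_def)
qed

lemma rat_cut_mono: "p \<le> q \<Longrightarrow> rat_cut p \<subseteq> rat_cut q"
  by (auto simp: rat_cut_def)

lemma infinite_rat_cut_diff:
  assumes "p < q" shows "infinite (rat_cut q - rat_cut p)"
proof -
  obtain u v where uv: "quotient_of p = (u, v)" by (cases "quotient_of p")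
  then have v: "v > 0" and p: "p = of_int u / of_int v"
    using quotient_of_denom_pos quotient_of_div by blast+
  \<comment> \<open>These are codes of \<open>p\<close> itself, which lies below \<open>q\<close>
    but not below \<open>p\<close>; the padding \<open>l\<close> gives infinitely many.\<close>
  define c where "c l = prod_encode (prod_encode (nat u, nat (- u)), prod_encode (nat v - 1, l))" for l
  have "rat_of_code (c l) = p" for l
    using v by (cases "u \<ge> 0") (simp_all add: rat_of_code_def c_def p of_nat_nat)
  then have "range c \<subseteq> rat_cut q - rat_cut p" using assms by (auto simp: rat_cut_def)
  moreover have "inj c" by (auto simp: inj_def c_def)
  ultimately show ?thesis by (meson infinite_super range_inj_infinite)
qed

definition column :: "nat \<Rightarrow> nat set" where
  "column n = {x. c1 x = n}"

lemma decidable_in_column: "decidable_in X (\<lambda>x. x \<in> column n)"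
  unfolding column_def by simp (intro comp_intros)

lemma infinite_column_diff:
  assumes "n \<noteq> m" shows "infinite (column n - column m)"
proof -
  have "range (\<lambda>l. prod_encode (n, l)) \<subseteq> column n - column m"
    using assms by (auto simp: column_def)
  moreover have "inj (\<lambda>l. prod_encode (n, l))" by (auto simp: inj_def)
  ultimately show ?thesis by (meson infinite_super range_inj_infinite)
qed

theorem corollary3p6:
  "\<exists>(A :: nat set) (B :: rat \<Rightarrow> nat set) (W :: nat \<Rightarrow> nat set).
     \<not> recursive_set A \<and> A \<le>\<^sub>T jump {} \<and>
     (\<forall>q\<in>{1<..<2}. B q \<equiv>\<^sub>b\<^sub>f\<^sub>o A) \<and>
     (\<forall>n. W n \<equiv>\<^sub>b\<^sub>f\<^sub>o A) \<and>
     (\<forall>p\<in>{1<..<2}. \<forall>q\<in>{1<..<2}. p < q \<longrightarrow> B p <\<^sub>1 B q) \<and>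
     (\<forall>n m. n \<noteq> m \<longrightarrow> \<not> W n \<le>\<^sub>1 W m) \<and>
     contains_copy_of (bfo_degree A) (UNIV :: rat set) (\<le>) \<and>
     contains_infinite_antichain (bfo_degree A)"
proof -
  define A where "A = copies {}"
  \<comment> \<open>Indexed by all rationals, the family serves both the interval (1,2) and the copy
    of the whole rational order.\<close>
  define B where "B q = copies (rat_cut q)" for q
  define W where "W n = copies (column n)" for n
  have B: "B q \<equiv>\<^sub>b\<^sub>f\<^sub>o A" for q
    unfolding A_def B_def by (intro copies_bfo_equiv decidable_in_rat_cut)
  have W: "W n \<equiv>\<^sub>b\<^sub>f\<^sub>o A" for n
    unfolding A_def W_def by (intro copies_bfo_equiv decidable_in_column)
  have le: "B p \<le>\<^sub>1 B q \<longleftrightarrow> p \<le> q" for p q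
  proof (cases "p \<le> q")
    case True
    then show ?thesis
      unfolding B_def by (simp add: copies_mono decidable_in_rat_cut rat_cut_mono)
  next
    case False
    then show ?thesis
      unfolding B_def by (simp add: copies_not_le decidable_in_rat_cut infinite_rat_cut_diff)
  qed
  have anti: "\<not> W n \<le>\<^sub>1 W m" if "n \<noteq> m" for n m
    unfolding W_def using that by (intro copies_not_le decidable_in_column infinite_column_diff)
  have "contains_copy_of (bfo_degree A) (UNIV :: rat set) (\<le>)"
    unfolding contains_copy_of_def
    by (intro exI[of _ "\<lambda>q. one_degree (B q)"])
      (simp add: one_degree_in_bfo_degree B one_degree_le_iff le)
  moreover have "contains_infinite_antichain (bfo_degree A)"
    unfolding contains_infinite_antichain_def
  proof (intro exI[of _ "range (\<lambda>n. one_degree (W n))"] conjI)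
    have "inj (\<lambda>n. one_degree (W n))"
      by (rule injI) (metis anti one_degree_le_iff one_le_refl)
    then show "infinite (range (\<lambda>n. one_degree (W n)))" by (rule range_inj_infinite)
  qed (auto simp: one_degree_in_bfo_degree W one_degree_le_iff, (metis anti)+)
  ultimately show ?thesis
    using not_recursive_copies_empty copies_empty_le_jump B W le anti
    by (intro exI[of _ A] exI[of _ B] exI[of _ W]) (auto simp: A_def one_less_def)
qed

end
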